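(* Let $\mathbf r=(\psi,\psi\cos\theta,\psi\sin\theta)$ be a space-periodic soliton on $LC^*$ of the flow $\frac{\partial\mathbf r}{\partial t}=(k_g)_s\mathbf r-k_g\mathbf T$, with integration constants $\lambda,\mu$. If the soliton rotates around the $x$-axis, then $\mu>0$ and $\psi$ is given by $$\psi=-\frac{k_g}{\sqrt\mu}.$$
   Context: $\mathbb E^3_1$ is $\mathbb R^3$ with coordinates $(x,y,z)$ and $\langle \mathbf u,\mathbf v\rangle_L=-u_1v_1+u_2v_2+u_3v_3$; $LC^*=\{(\psi,\psi\cos\theta,\psi\sin\theta):\psi>0\}$. For a smooth curve $\mathbf r$ on $LC^*$ with space-like velocity, $s$ is arc length, $\mathbf T=\mathbf r_s$, $\mathbf Y$ is the unique light-like field along $\mathbf r$ with $\langle \mathbf Y,\mathbf T\rangle_L=0$, $\langle\mathbf r,\mathbf Y\rangle_L=1$, and $k_g=\langle\mathbf r_{ss},\mathbf Y\rangle_L$. Curves are oriented so that $d\theta/ds=1/\psi$. A soliton of the flow is a curve moving by isometries under it; equivalently $(k_g)_{sss}-3k_g(k_g)_s=0$, which integrates to $$(k_g)_{ss}-\tfrac32k_g^2+\tfrac\lambda2=0,\qquad ((k_g)_s)^2-k_g^3+\lambda k_g+\mu=0$$ with integration constants $\lambda,\mu$. A space-periodic soliton is one for which $k_g(s)$, $s\in\mathbb R$, is non-constant and periodic; then $\lambda>3(\mu/2)^{2/3}$, the cubic $x^3-\lambda x-\mu$ has three distinct real roots $x_1<x_2<x_3$, and $k_g$ oscillates between $x_1$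 and $x_2$. The soliton "rotates around the $x$-axis" if the isometries moving it are the rotations about the $x$-axis, i.e. along $\mathbf r$ the field $\mathbf J=(k_g)_s\mathbf r-k_g\mathbf T$ is a non-zero constant multiple of the Killing field $\partial_\theta$ (generator $-z\partial_y+y\partial_z$). *)

theory Defs
  imports "HOL-Analysis.Analysis"
begin

definition lorentz :: "real^3 \<Rightarrow> real^3 \<Rightarrow> real" where
  "lorentz u v = - u$1 * v$1 + u$2 * v$2 + u$3 * v$3"

definition cone_point :: "real \<Rightarrow> real \<Rightarrow> real^3" where
  "cone_point \<psi> \<theta> = vector [\<psi>, \<psi> * cos \<theta>, \<psi> * sin \<theta>]"

definition light_cone :: "(real^3) set" where
  "light_cone = {cone_point \<psi> \<theta> | \<psi> \<theta>. \<psi> > 0}"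

definition light_like :: "real^3 \<Rightarrow> bool" where
  "light_like v \<longleftrightarrow> v \<noteq> 0 \<and> lorentz v v = 0"

definition smooth_curve :: "(real \<Rightarrow> 'a::real_normed_vector) \<Rightarrow> bool" where
  "smooth_curve f \<longleftrightarrow>
     (\<forall>n. ((\<lambda>g s. vector_derivative g (at s)) ^^ n) f differentiable_on UNIV)"

text \<open>Curves are parametrised by arc length \<open>s\<close>, ranging over the whole real line.\<close>

definition tangent :: "(real \<Rightarrow> real^3) \<Rightarrow> real \<Rightarrow> real^3" where
  "tangent r s = vector_derivative r (at s)"

definition arc_length_curve :: "(real \<Rightarrow> real^3) \<Rightarrow> bool" where
  "arc_length_curve r \<longleftrightarrow>
     smooth_curve r \<and> (\<forall>s. r s \<in> light_cone) \<and> (\<forall>s. lorentz (tangent r s) (tangent r s) = 1)"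

text \<open>The second coordinate \<open>\<theta>\<close> is a continuous angle along the curve (not reduced modulo
  \<open>2 * pi\<close>); the orientation is \<open>d\<theta>/ds = 1/\<psi>\<close>, the other one being \<open>d\<theta>/ds = - 1/\<psi>\<close>.\<close>

definition oriented_polar :: "(real \<Rightarrow> real^3) \<Rightarrow> (real \<Rightarrow> real) \<Rightarrow> (real \<Rightarrow> real) \<Rightarrow> bool" where
  "oriented_polar r \<psi> \<theta> \<longleftrightarrow>
     (\<forall>s. \<psi> s > 0 \<and> r s = cone_point (\<psi> s) (\<theta> s) \<and>
          (\<theta> has_real_derivative 1 / \<psi> s) (at s))"

definition Y_field :: "(real \<Rightarrow> real^3) \<Rightarrow> real \<Rightarrow> real^3" where
  "Y_field r s = (THE y. light_like y \<and> lorentz y (tangent r s) = 0 \<and> lorentz (r s) y = 1)"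

definition k_g :: "(real \<Rightarrow> real^3) \<Rightarrow> real \<Rightarrow> real" where
  "k_g r s = lorentz (vector_derivative (tangent r) (at s)) (Y_field r s)"

definition J_field :: "(real \<Rightarrow> real^3) \<Rightarrow> real \<Rightarrow> real^3" where
  "J_field r s = deriv (k_g r) s *\<^sub>R r s - k_g r s *\<^sub>R tangent r s"

text \<open>A solution is a family \<open>R t\<close> of curves. The flow preserves arc length, so \<open>s\<close> is an
  arc length parameter at every time.\<close>

definition flow_solution :: "(real \<Rightarrow> real \<Rightarrow> real^3) \<Rightarrow> bool" where
  "flow_solution R \<longleftrightarrow>
     (\<forall>t. arc_length_curve (R t)) \<and>
     (\<forall>t s. ((\<lambda>t'. R t' s) has_vector_derivative J_field (R t) s) (at t))"

text \<open>Isometries are those of the ambient Minkowski space preserving the cone. (The degenerate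
  metric induced on the cone has an infinite-dimensional isometry group, under which \<open>k_g\<close>
  is not invariant.)\<close>

definition cone_isometry :: "(real^3 \<Rightarrow> real^3) \<Rightarrow> bool" where
  "cone_isometry A \<longleftrightarrow>
     linear A \<and> (\<forall>u v. lorentz (A u) (A v) = lorentz u v) \<and> A ` light_cone = light_cone"

definition soliton :: "(real \<Rightarrow> real^3) \<Rightarrow> bool" where
  "soliton r \<longleftrightarrow>
     (\<exists>A. (\<forall>t. cone_isometry (A t)) \<and> A 0 = id \<and> flow_solution (\<lambda>t s. A t (r s)))"

definition integration_constants :: "(real \<Rightarrow> real^3) \<Rightarrow> real \<Rightarrow> real \<Rightarrow> bool" where
  "integration_constants r lam \<mu> \<longleftrightarrow>
     (\<forall>s. deriv (deriv (k_g r)) s - 3/2 * (k_g r s)^2 + lam/2 = 0 \<and>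
          (deriv (k_g r) s)^2 - (k_g r s)^3 + lam * k_g r s + \<mu> = 0)"

definition space_periodic :: "(real \<Rightarrow> real^3) \<Rightarrow> bool" where
  "space_periodic r \<longleftrightarrow>
     (\<exists>s s'. k_g r s \<noteq> k_g r s') \<and> (\<exists>p>0. \<forall>s. k_g r (s + p) = k_g r s)"

definition rotation_field :: "real^3 \<Rightarrow> real^3" where
  "rotation_field v = vector [0, - v$3, v$2]"

definition rotates_about_x_axis :: "(real \<Rightarrow> real^3) \<Rightarrow> bool" where
  "rotates_about_x_axis r \<longleftrightarrow>
     (\<exists>c. c \<noteq> 0 \<and> (\<forall>s. J_field r s = c *\<^sub>R rotation_field (r s)))"

end

theory Submission
  imports Defs
begin

text \<open>In polar coordinates, \<open>J = c \<partial>\<^sub>\<theta>\<close> says \<open>k\<^sub>g = - c \<psi>\<close>. Substituting this into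
  \<open>\<psi>\<^sup>2 k\<^sub>g = \<psi> \<psi>'' - (\<psi>'\<^sup>2 + 1) / 2\<close> and eliminating the derivatives by the integrated soliton
  equations leaves \<open>\<mu> = c\<^sup>2 > 0\<close>. If \<open>c\<close> were negative, \<open>k\<^sub>g\<close> would be positive, so its minimum
  \<open>m\<close> and maximum \<open>M\<close> would be two distinct positive roots of \<open>x\<^sup>3 - \<lambda> x - \<mu>\<close>; the third
  root is \<open>- (m + M)\<close>, so that \<open>\<mu> = - m M (m + M) < 0\<close>, a contradiction.\<close>

section \<open>Derivatives of smooth curves, coordinate by coordinate\<close>

lemma differentiable_vec_nth_deriv:
  fixes f :: "real \<Rightarrow> real^'n"
  assumes "f differentiable at s"
  shows "((\<lambda>s. f s $ i) has_real_derivative vector_derivative f (at s) $ i) (at s)"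
  using bounded_linear.has_vector_derivative[OF bounded_linear_vec_nth
      assms[unfolded vector_derivative_works]]
  by (simp add: has_real_derivative_iff_has_vector_derivative)

lemma smooth_curve_differentiable:
  assumes "smooth_curve r"
  shows "r differentiable at s" "tangent r differentiable at s"
proof -
  have "((\<lambda>g s. vector_derivative g (at s)) ^^ 0) r differentiable_on UNIV"
    and "((\<lambda>g s. vector_derivative g (at s)) ^^ Suc 0) r differentiable_on UNIV"
    using assms unfolding smooth_curve_def by blast+
  then show "r differentiable at s" "tangent r differentiable at s"
    by (simp_all add: differentiable_on_def tangent_def[abs_def])
qed

section \<open>The null vector conjugate to a point of the cone\<close>

lemma cone_point_nth [simp]:
  "cone_point \<psi> \<theta> $ 1 = \<psi>" "cone_point \<psi> \<theta> $ 2 = \<psi> * cos \<theta>" "cone_point \<psi> \<theta> $ 3 = \<psi> * sin \<theta>"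
  by (simp_all add: cone_point_def)

text \<open>The null vector \<open>y\<close> is recovered from its coordinates \<open>P\<close>, \<open>Q\<close> along the radial and angular
  unit vectors of the \<open>y z\<close>-plane: the two linear conditions give \<open>P - y\<^sub>1\<close> and \<open>Q\<close>, and
  then light-likeness gives \<open>P + y\<^sub>1\<close>.\<close>

lemma conjugate_null_vector_iff:
  fixes y v :: "real^3"
  assumes "\<psi> > 0"
    and v: "v = vector [d, d * cos \<theta> - sin \<theta>, d * sin \<theta> + cos \<theta>]"
  shows "light_like y \<and> lorentz y v = 0 \<and> lorentz (cone_point \<psi> \<theta>) y = 1 \<longleftrightarrow>
    y = vector [- (d\<^sup>2 + 1) / (2 * \<psi>),
                (1 - d\<^sup>2) / (2 * \<psi>) * cos \<theta> + d / \<psi> * sin \<theta>,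
                (1 - d\<^sup>2) / (2 * \<psi>) * sin \<theta> - d / \<psi> * cos \<theta>]"
    (is "?L \<longleftrightarrow> y = ?Y")
proof
  define C S where "C = cos \<theta>" and "S = sin \<theta>"
  have CS: "C\<^sup>2 + S\<^sup>2 = 1"
    by (simp add: C_def S_def)
  define P Q where "P = C * y$2 + S * y$3" and "Q = C * y$3 - S * y$2"
  assume L: ?L
  have radial: "\<psi> * (P - y$1) = 1"
    using L by (simp add: lorentz_def P_def C_def S_def algebra_simps)
  have "d * (P - y$1) + Q = 0"
    using L by (simp add: v lorentz_def P_def Q_def C_def S_def algebra_simps)
  moreover have diff: "P - y$1 = 1 / \<psi>"
    using radial \<open>\<psi> > 0\<close> by (simp add: field_simps)
  ultimately have Q: "Q = - d / \<psi>"
    by simp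
  \<comment> \<open>Passing to \<open>P\<close>, \<open>Q\<close> is a rotation of the
    \<open>y z\<close>-plane, so it preserves the Euclidean length there.\<close>
  have "P\<^sup>2 + Q\<^sup>2 = (C\<^sup>2 + S\<^sup>2) * ((y$2)\<^sup>2 + (y$3)\<^sup>2)"
    unfolding P_def Q_def by algebra
  also have "\<dots> = (y$1)\<^sup>2"
    using L unfolding CS by (simp add: light_like_def lorentz_def power2_eq_square)
  finally have "(P - y$1) * (P + y$1) = - Q\<^sup>2"
    by (simp add: algebra_simps power2_eq_square)
  then have "P + y$1 = - \<psi> * Q\<^sup>2"
    using radial by algebra
  then have sum: "P + y$1 = - d\<^sup>2 / \<psi>"
    unfolding Q by (simp add: power2_eq_square)
  have P: "P = (1 - d\<^sup>2) / (2 * \<psi>)" and y1: "y$1 = - (d\<^sup>2 + 1) / (2 * \<psi>)"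
    using diff sum \<open>\<psi> > 0\<close> by (simp_all add: field_simps)
  have "y$2 = P * C - Q * S" "y$3 = P * S + Q * C"
    using CS unfolding P_def Q_def by algebra+
  then show "y = ?Y"
    using y1 unfolding P Q by (simp add: vec_eq_iff forall_3 C_def S_def)
next
  define C S where "C = cos \<theta>" and "S = sin \<theta>"
  have CS: "C\<^sup>2 + S\<^sup>2 = 1"
    by (simp add: C_def S_def)
  \<comment> \<open>\<open>a\<close>, \<open>b\<close> and \<open>- e\<close> are the
    \<open>x\<close>, radial and angular coordinates of the claimed vector. The three relations
    below encode the pairing with the point, orthogonality to \<open>v\<close>, and nullity.\<close>
  define a b e where "a = - (d\<^sup>2 + 1) / (2 * \<psi>)" and "b = (1 - d\<^sup>2) / (2 * \<psi>)" and "e = d / \<psi>"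
  have ab: "\<psi> * (b - a) = 1" and ae: "d * (b - a) = e" and abe: "b\<^sup>2 + e\<^sup>2 = a\<^sup>2"
    using \<open>\<psi> > 0\<close> by (simp_all add: a_def b_def e_def field_simps power2_eq_square)
  assume "y = ?Y"
  then have y: "y$1 = a" "y$2 = b * C + e * S" "y$3 = b * S - e * C"
    by (simp_all add: a_def b_def e_def C_def S_def)
  have "a < 0"
    using \<open>\<psi> > 0\<close> zero_le_power2[of d] unfolding a_def by (intro divide_neg_pos) linarith+
  then have "y \<noteq> 0"
    using y(1) by auto
  moreover have "lorentz y y = 0"
    unfolding lorentz_def y using CS abe by algebra
  moreover have "lorentz y v = 0"
    unfolding lorentz_def y v vector_3 C_def[symmetric] S_def[symmetric]
    using CS ae by algebra
  moreover have "lorentz (cone_point \<psi> \<theta>) y = 1"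
    unfolding lorentz_def y cone_point_nth C_def[symmetric] S_def[symmetric]
    using CS ab by algebra
  ultimately show ?L
    by (simp add: light_like_def)
qed

section \<open>Extrema of continuous periodic functions\<close>

lemma periodic_continuous_attains_bounds:
  fixes f :: "real \<Rightarrow> real"
  assumes "p > 0" "\<And>s. f (s + p) = f s" "continuous_on UNIV f"
  obtains a b where "\<And>s. f a \<le> f s" "\<And>s. f s \<le> f b"
proof -
  have cont: "continuous_on {0..p} f"
    using assms(3) continuous_on_subset by blast
  have shift: "f (x + real n * p) = f x" for x n
  proof (induction n)
    case (Suc n)
    then show ?case
      using assms(2)[of "x + real n * p"] by (simp add: algebra_simps)
  qed simp
  have shift_int: "f (x + of_int z * p) = f x" for x z
  proof (cases "z \<ge> 0")
    case True
    then show ?thesis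
      using shift[of x "nat z"] by simp
  next
    case False
    then show ?thesis
      \<comment> \<open>For negative \<open>z\<close>, start from the translated point and move
        \<open>- z\<close> periods to the right, back to \<open>x\<close>.\<close>
      using shift[of "x + of_int z * p" "nat (- z)"] by simp
  qed
  \<comment> \<open>Every value is taken on the compact interval \<open>{0..p}\<close>: the
    representative of \<open>s\<close> is \<open>s - p * \<lfloor>s / p\<rfloor>\<close>, that is
    \<open>p * frac (s / p)\<close>.\<close>
  have reduce: "\<exists>x\<in>{0..p}. f s = f x" for s
  proof
    show "f s = f (p * frac (s / p))"
      using shift_int[of "p * frac (s / p)" "\<lfloor>s / p\<rfloor>"] \<open>p > 0\<close>
      by (simp add: frac_def algebra_simps)
    show "p * frac (s / p) \<in> {0..p}"
      using \<open>p > 0\<close> frac_lt_1[of "s / p"] by (simp add: mult_left_le)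
  qed
  obtain a where "\<forall>x\<in>{0..p}. f a \<le> f x"
    using continuous_attains_inf[OF _ _ cont] \<open>p > 0\<close> by auto
  moreover obtain b where "\<forall>x\<in>{0..p}. f x \<le> f b"
    using continuous_attains_sup[OF _ _ cont] \<open>p > 0\<close> by auto
  ultimately show ?thesis
    using that reduce by metis
qed

section \<open>Moving frame and curvature in polar coordinates\<close>

locale oriented_arc_length_curve =
  fixes r :: "real \<Rightarrow> real^3" and \<psi> \<theta> :: "real \<Rightarrow> real"
  assumes curve: "arc_length_curve r" and polar: "oriented_polar r \<psi> \<theta>"
begin

lemma \<psi>_pos: "\<psi> s > 0"
  using polar by (simp add: oriented_polar_def)

lemma r_polar: "r s = cone_point (\<psi> s) (\<theta> s)"
  using polar by (simp add: oriented_polar_def)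

lemma \<theta>_deriv: "(\<theta> has_real_derivative 1 / \<psi> s) (at s)"
  using polar by (simp add: oriented_polar_def)

text \<open>Taken from the coordinates of \<open>r\<close>, so that the differentiability of \<psi>
  and of its derivative is inherited from the smoothness of \<open>r\<close>;
  \<open>oriented_polar\<close> provides it only for \<theta>.\<close>

definition \<psi>' where "\<psi>' s = tangent r s $ 1"
definition \<psi>'' where "\<psi>'' s = vector_derivative (tangent r) (at s) $ 1"

lemma r_nth_deriv: "((\<lambda>s. r s $ i) has_real_derivative tangent r s $ i) (at s)"
  unfolding tangent_def
  using curve by (intro differentiable_vec_nth_deriv smooth_curve_differentiable)
    (simp add: arc_length_curve_def)

lemma tangent_nth_deriv:
  "((\<lambda>s. tangent r s $ i) has_real_derivative vector_derivative (tangent r) (at s) $ i) (at s)"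
  using curve by (intro differentiable_vec_nth_deriv smooth_curve_differentiable)
    (simp add: arc_length_curve_def)

lemma \<psi>_deriv: "(\<psi> has_real_derivative \<psi>' s) (at s)"
  using r_nth_deriv[of 1 s] by (simp add: r_polar \<psi>'_def)

lemma \<psi>'_deriv: "(\<psi>' has_real_derivative \<psi>'' s) (at s)"
  using tangent_nth_deriv[of 1 s] by (simp add: \<psi>'_def[abs_def] \<psi>''_def)

text \<open>The angular component is \<psi> times the derivative of \<theta>, which the orientation
  makes equal to 1.\<close>

lemma tangent_polar:
  "tangent r s =
    vector [\<psi>' s, \<psi>' s * cos (\<theta> s) - sin (\<theta> s), \<psi>' s * sin (\<theta> s) + cos (\<theta> s)]"
proof -
  have "((\<lambda>s. \<psi> s * cos (\<theta> s)) has_real_derivative \<psi>' s * cos (\<theta> s) - sin (\<theta> s)) (at s)"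
    and "((\<lambda>s. \<psi> s * sin (\<theta> s)) has_real_derivative \<psi>' s * sin (\<theta> s) + cos (\<theta> s)) (at s)"
    using \<psi>_pos[of s] by (auto intro!: derivative_eq_intros \<psi>_deriv \<theta>_deriv)
  then have "tangent r s $ 2 = \<psi>' s * cos (\<theta> s) - sin (\<theta> s)"
    and "tangent r s $ 3 = \<psi>' s * sin (\<theta> s) + cos (\<theta> s)"
    using r_nth_deriv[of 2 s] r_nth_deriv[of 3 s] by (auto simp: r_polar dest: DERIV_unique)
  then show ?thesis
    by (simp add: vec_eq_iff forall_3 \<psi>'_def)
qed

text \<open>The radial unit vector turns towards the angular one at rate \<open>1 / \<psi>\<close>,
  and the angular one towards minus the radial one at the same rate.\<close>

lemma acceleration_polar:
  "vector_derivative (tangent r) (at s) =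
    vector [\<psi>'' s,
            (\<psi>'' s - 1 / \<psi> s) * cos (\<theta> s) - \<psi>' s / \<psi> s * sin (\<theta> s),
            (\<psi>'' s - 1 / \<psi> s) * sin (\<theta> s) + \<psi>' s / \<psi> s * cos (\<theta> s)]"
proof -
  have "((\<lambda>s. \<psi>' s * cos (\<theta> s) - sin (\<theta> s)) has_real_derivative
      (\<psi>'' s - 1 / \<psi> s) * cos (\<theta> s) - \<psi>' s / \<psi> s * sin (\<theta> s)) (at s)"
    and "((\<lambda>s. \<psi>' s * sin (\<theta> s) + cos (\<theta> s)) has_real_derivative
      (\<psi>'' s - 1 / \<psi> s) * sin (\<theta> s) + \<psi>' s / \<psi> s * cos (\<theta> s)) (at s)"
    by (auto intro!: derivative_eq_intros \<psi>'_deriv \<theta>_deriv simp: algebra_simps)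
  then show ?thesis
    using tangent_nth_deriv[of 2 s] tangent_nth_deriv[of 3 s]
    by (auto simp: vec_eq_iff forall_3 \<psi>''_def tangent_polar dest: DERIV_unique)
qed

text \<open>The equivalence for null vectors turns the description into
  \<open>THE y. y = ...\<close>, settling existence and uniqueness together.\<close>

lemma Y_field_polar:
  "Y_field r s = vector [- ((\<psi>' s)\<^sup>2 + 1) / (2 * \<psi> s),
     (1 - (\<psi>' s)\<^sup>2) / (2 * \<psi> s) * cos (\<theta> s) + \<psi>' s / \<psi> s * sin (\<theta> s),
     (1 - (\<psi>' s)\<^sup>2) / (2 * \<psi> s) * sin (\<theta> s) - \<psi>' s / \<psi> s * cos (\<theta> s)]"
  unfolding Y_field_def r_polar[of s] conjugate_null_vector_iff[OF \<psi>_pos tangent_polar]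
  by simp

lemma k_g_polar: "(\<psi> s)\<^sup>2 * k_g r s = \<psi> s * \<psi>'' s - ((\<psi>' s)\<^sup>2 + 1) / 2"
proof -
  define C S where "C = cos (\<theta> s)" and "S = sin (\<theta> s)"
  have CS: "C\<^sup>2 + S\<^sup>2 = 1"
    by (simp add: C_def S_def)
  define a b e where "a = - ((\<psi>' s)\<^sup>2 + 1) / (2 * \<psi> s)"
    and "b = (1 - (\<psi>' s)\<^sup>2) / (2 * \<psi> s)" and "e = \<psi>' s / \<psi> s"
  \<comment> \<open>In the rotated frame the acceleration is
    \<open>(\<psi>'', \<psi>'' - 1/\<psi>, e)\<close> and \<open>Y\<close> is
    \<open>(a, b, - e)\<close>; this is their Lorentz product.\<close>
  have "k_g r s = \<psi>'' s * (b - a) - 1 / \<psi> s * b - e\<^sup>2"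
    unfolding k_g_def lorentz_def acceleration_polar Y_field_polar vector_3
      C_def[symmetric] S_def[symmetric] a_def[symmetric] b_def[symmetric] e_def[symmetric]
    using CS by algebra
  moreover have "\<psi> s * (b - a) = 1"
    using \<psi>_pos[of s] by (simp add: a_def b_def field_simps)
  moreover have "\<psi> s * (1 / \<psi> s) = 1"
    using \<psi>_pos[of s] by simp
  ultimately have "(\<psi> s)\<^sup>2 * k_g r s = \<psi> s * \<psi>'' s - \<psi> s * b - (\<psi> s * e)\<^sup>2"
    by algebra
  moreover have "\<psi> s * b = (1 - (\<psi>' s)\<^sup>2) / 2" "\<psi> s * e = \<psi>' s"
    using \<psi>_pos[of s] by (simp_all add: b_def e_def)
  ultimately show ?thesis
    by (simp add: diff_divide_distrib add_divide_distrib)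
qed

text \<open>Compare angular components: \<open>r\<close> has none and the tangent has 1, so that of
  \<open>J\<close> is minus \<open>k_g\<close>, while that of the rotation field is \<psi>.\<close>

lemma J_field_rotation:
  assumes "J_field r s = c *\<^sub>R rotation_field (r s)"
  shows "k_g r s = - c * \<psi> s"
proof -
  define C S where "C = cos (\<theta> s)" and "S = sin (\<theta> s)"
  have CS: "C\<^sup>2 + S\<^sup>2 = 1"
    by (simp add: C_def S_def)
  have "J_field r s $ 2 = (c *\<^sub>R rotation_field (r s)) $ 2"
    and "J_field r s $ 3 = (c *\<^sub>R rotation_field (r s)) $ 3"
    using assms by simp_all
  then have "deriv (k_g r) s * (\<psi> s * C) - k_g r s * (\<psi>' s * C - S) = - c * (\<psi> s * S)"
    and "deriv (k_g r) s * (\<psi> s * S) - k_g r s * (\<psi>' s * S + C) = c * (\<psi> s * C)"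
    by (simp_all add: J_field_def rotation_field_def r_polar tangent_polar C_def S_def)
  then show ?thesis
    using CS by algebra
qed

end

section \<open>Identification of the rotation speed\<close>

theorem proposition4p4:
  fixes r :: "real \<Rightarrow> real^3" and \<psi> \<theta> :: "real \<Rightarrow> real" and lam \<mu> :: real
  assumes "arc_length_curve r"
    and "oriented_polar r \<psi> \<theta>"
    and "soliton r"
    and "integration_constants r lam \<mu>"
    and "space_periodic r"
    and "rotates_about_x_axis r"
  shows "\<mu> > 0 \<and> (\<forall>s. \<psi> s = - k_g r s / sqrt \<mu>)"
proof -
  interpret oriented_arc_length_curve r \<psi> \<theta>
    using assms by unfold_locales
  obtain c where "c \<noteq> 0" and k: "\<And>s. k_g r s = - c * \<psi> s"
    using assms(6) J_field_rotation unfolding rotates_about_x_axis_def by blast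
  have k_eq: "k_g r = (\<lambda>s. - c * \<psi> s)"
    using k by (rule ext)
  have k_deriv: "(k_g r has_real_derivative - c * \<psi>' s) (at s)" for s
    unfolding k_eq by (auto intro!: derivative_eq_intros \<psi>_deriv)
  then have k': "deriv (k_g r) = (\<lambda>s. - c * \<psi>' s)"
    by (auto intro: DERIV_imp_deriv)
  have k'': "deriv (deriv (k_g r)) s = - c * \<psi>'' s" for s
    unfolding k' by (rule DERIV_imp_deriv) (auto intro!: derivative_eq_intros \<psi>'_deriv)
  have ode2: "deriv (deriv (k_g r)) s - 3/2 * (k_g r s)^2 + lam/2 = 0"
    and ode1: "(deriv (k_g r) s)^2 - (k_g r s)^3 + lam * k_g r s + \<mu> = 0" for s
    using assms(4) unfolding integration_constants_def by blast+
  have \<mu>: "\<mu> = c\<^sup>2"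
  proof -
    define K where "K = k_g r 0"
    have "2 * ((\<psi> 0)\<^sup>2 * K) = 2 * (\<psi> 0 * \<psi>'' 0) - (\<psi>' 0)\<^sup>2 - 1"
      using k_g_polar[of 0] by (simp add: K_def field_simps)
    moreover have "2 * (- c * \<psi>'' 0) - 3 * K\<^sup>2 + lam = 0"
      using ode2[of 0] by (simp add: K_def k'')
    moreover have "(- c * \<psi>' 0)\<^sup>2 - K^3 + lam * K + \<mu> = 0"
      using ode1[of 0] unfolding k' K_def .
    moreover have "K = - c * \<psi> 0"
      using k[of 0] by (simp add: K_def)
    \<comment> \<open>Multiplying the curvature identity by \<open>c\<^sup>2\<close> and using
      \<open>c\<^sup>2 * \<psi>\<^sup>2 = K\<^sup>2\<close> expresses \<open>2 * K^3\<close> through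
      the derivatives of \<psi>. With \<open>lam\<close> taken from the second-order equation, the
      first-order one then leaves only \<open>\<mu> = c\<^sup>2\<close>.\<close>
    ultimately show ?thesis
      by algebra
  qed
  have "c > 0"
  proof (rule ccontr)
    assume "\<not> c > 0"
    then have k_pos: "k_g r s > 0" for s
      using \<open>c \<noteq> 0\<close> \<psi>_pos[of s] by (simp add: k mult_neg_pos)
    have "continuous_on UNIV (k_g r)"
      using k_deriv DERIV_isCont continuous_at_imp_continuous_on by blast
    then obtain a b where lower: "\<And>s. k_g r a \<le> k_g r s" and upper: "\<And>s. k_g r s \<le> k_g r b"
      using assms(5) periodic_continuous_attains_bounds unfolding space_periodic_def by metis
    define m M where "m = k_g r a" and "M = k_g r b"
    have "deriv (k_g r) a = 0" "deriv (k_g r) b = 0"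
      using DERIV_local_min[OF k_deriv zero_less_one, of a]
        DERIV_local_max[OF k_deriv zero_less_one, of b] lower upper
      by (simp_all add: k')
    then have "m^3 - lam * m - \<mu> = 0" "M^3 - lam * M - \<mu> = 0"
      using ode1[of a] ode1[of b] by (simp_all add: m_def M_def)
    \<comment> \<open>Subtracting \<open>m\<close> times the second equation from \<open>M\<close>
      times the first cancels \<open>lam\<close>.\<close>
    then have "(M - m) * (\<mu> + m * M * (m + M)) = 0"
      by algebra
    moreover have "m \<noteq> M"
      using assms(5) lower upper unfolding space_periodic_def m_def M_def
      by (metis order_antisym)
    ultimately have "\<mu> = - (m * M * (m + M))"
      by simp
    moreover have "m * M * (m + M) > 0"
      using k_pos by (simp add: m_def M_def add_pos_pos)
    ultimately show False
      using \<mu> by (metis neg_less_0_iff_less not_less zero_le_power2)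
  qed
  \<comment> \<open>Positivity of \<open>c\<close> selects the sign of the root:
    \<open>sqrt \<mu> = c\<close>.\<close>
  then show ?thesis
    using \<mu> k by simp
qed

end
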